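(* The quadratic Poisson algebra $$\{s_n,s_m\}=\sum_{l\in\mathbb{Z}}c_l\,s_{n-2l}\,s_{m+2l}\quad(n,m\in 2\mathbb{Z}),\qquad c_l=-2\ln q\,\frac{q^{l}-q^{-l}}{q^{l}+q^{-l}},$$ has central extensions of the form $$h_{n,m}=\xi_{n+m}\left(q^{\frac12(m-n)}-q^{\frac12(n-m)}\right),$$ where $\xi_n$ is a completely arbitrary function of $n$.
   Context: Here $q$ is the deformation parameter and the generators are $s_n$, $n\in 2\mathbb{Z}$. This algebra is the case $k=0$ of the family of quadratic Poisson algebras, indexed by a non-negative integer $k$, with structure coefficients $c^{(k)}_l=(-1)^{k+1}\,2\ln q\,\frac{q^{(2k+1)l}-q^{-(2k+1)l}}{q^l+q^{-l}}$. A central extension is a bracket $$\{s_n,s_m\}=\sum_{l\in\mathbb{Z}}c_l\,s_{n-2l}\,s_{m+2l}+h_{n,m},$$ where $h_{n,m}$ Poisson-commutes with all $s_r$ and $h_{n,m}=-h_{m,n}$. The Jacobi identity for this bracket leads to the following cocycle equation, for $m,n,r,l\in 2\mathbb{Z}$: $$c_{\frac{l-r}{2}}(h_{n,m-l+r}-h_{m,n-l+r})+c_{\frac{l-m}{2}}(h_{r,n-l+m}-h_{n,r-l+m})+c_{\frac{l-n}{2}}(h_{m,r-l+n}-h_{r,m-l+n})=0.$$ *)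

theory Defs
  imports
    "HOL-Library.Multiset"
    "HOL-Library.Groups_Big_Fun"
    "HOL-Analysis.Complex_Transcendental"
begin

text \<open>
  Formal series in commuting generators \<open>s\<^sub>n\<close>, with coefficients in a commutative ring \<open>'z\<close>
  of central elements (a complex algebra, e.g. the complex numbers). A monomial is the
  multiset of the indices of its generators; a series is its coefficient function.
\<close>

type_synonym 'z series = "int multiset \<Rightarrow> 'z"

definition const :: "'z::comm_ring_1 \<Rightarrow> 'z series" where
  "const z = (\<lambda>M. if M = {#} then z else 0)"

definition gen :: "int \<Rightarrow> 'z::comm_ring_1 series" where
  "gen n = (\<lambda>M. if M = {#n#} then 1 else 0)"

definition ser_add :: "'z::comm_ring_1 series \<Rightarrow> 'z series \<Rightarrow> 'z series" where
  "ser_add f g = (\<lambda>M. f M + g M)"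

definition ser_mult :: "'z::comm_ring_1 series \<Rightarrow> 'z series \<Rightarrow> 'z series" where
  "ser_mult f g = (\<lambda>M. \<Sum>P | P \<subseteq># M. f P * g (M - P))"

text \<open>The partial derivative with respect to the generator \<open>s\<^sub>p\<close>.\<close>

definition ser_deriv :: "int \<Rightarrow> 'z::comm_ring_1 series \<Rightarrow> 'z series" where
  "ser_deriv p f = (\<lambda>M. of_nat (Suc (count M p)) * f (add_mset p M))"

text \<open>
  Infinite sums of series are taken coefficientwise, each coefficient being a sum with
  finitely many nonzero terms (\<^const>\<open>Sum_any\<close> would return \<open>0\<close> otherwise).
\<close>

definition ser_sum :: "('i \<Rightarrow> 'z::comm_ring_1 series) \<Rightarrow> 'z series" where
  "ser_sum F = (\<lambda>M. Sum_any (\<lambda>i. F i M))"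

text \<open>The bracket \<open>{s\<^sub>n, s\<^sub>m}\<close> of two generators.\<close>

definition gen_bracket ::
    "(int \<Rightarrow> 'z::comm_ring_1) \<Rightarrow> (int \<Rightarrow> int \<Rightarrow> 'z) \<Rightarrow> int \<Rightarrow> int \<Rightarrow> 'z series" where
  "gen_bracket c h n m =
     ser_add
       (ser_sum (\<lambda>l. ser_mult (const (c l)) (ser_mult (gen (n - 2 * l)) (gen (m + 2 * l)))))
       (const (h n m))"

text \<open>
  Its extension as a biderivation, linear over \<open>'z\<close>. In \<open>{{s\<^sub>n, s\<^sub>m}, s\<^sub>r}\<close> every coefficient is a
  finite sum, whatever \<open>c\<close> and \<open>h\<close> are: only \<open>r' = r\<close> contributes, and a term \<open>p\<close> contributes to
  the monomial \<open>M\<close> only if \<open>n + m - p\<close> belongs to \<open>M\<close>. Generators of odd index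
  play no role: the derivatives \<open>ser_deriv p f\<close> with \<open>p\<close> odd vanish for a series \<open>f\<close> in the
  \<open>s\<^sub>n\<close> with \<open>n\<close> even.
\<close>

definition bracket ::
    "(int \<Rightarrow> 'z::comm_ring_1) \<Rightarrow> (int \<Rightarrow> int \<Rightarrow> 'z) \<Rightarrow> 'z series \<Rightarrow> 'z series \<Rightarrow> 'z series" where
  "bracket c h f g =
     ser_sum (\<lambda>(p, r'). ser_mult (ser_mult (ser_deriv p f) (ser_deriv r' g)) (gen_bracket c h p r'))"

definition jacobi_on_gens :: "(int \<Rightarrow> 'z::comm_ring_1) \<Rightarrow> (int \<Rightarrow> int \<Rightarrow> 'z) \<Rightarrow> bool" where
  "jacobi_on_gens c h \<longleftrightarrow>
     (\<forall>n m r. even n \<longrightarrow> even m \<longrightarrow> even r \<longrightarrow>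
        ser_add (bracket c h (bracket c h (gen n) (gen m)) (gen r))
          (ser_add (bracket c h (bracket c h (gen m) (gen r)) (gen n))
                   (bracket c h (bracket c h (gen r) (gen n)) (gen m))) = const 0)"

definition central_extension :: "(int \<Rightarrow> 'z::comm_ring_1) \<Rightarrow> (int \<Rightarrow> int \<Rightarrow> 'z) \<Rightarrow> bool" where
  "central_extension c h \<longleftrightarrow>
     (\<forall>n m r. even n \<longrightarrow> even m \<longrightarrow> even r \<longrightarrow> bracket c h (const (h n m)) (gen r) = const 0) \<and>
     (\<forall>n m. even n \<longrightarrow> even m \<longrightarrow> h n m = - h m n) \<and>
     jacobi_on_gens c h"

definition c_coeff :: "complex \<Rightarrow> int \<Rightarrow> complex" where
  "c_coeff q l = - 2 * Ln q * ((q powi l - q powi (- l)) / (q powi l + q powi (- l)))"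

text \<open>For even \<open>n\<close> and \<open>m\<close> the divisions by 2 are exact.\<close>

definition h_coeff :: "complex \<Rightarrow> int \<Rightarrow> int \<Rightarrow> complex" where
  "h_coeff q n m = q powi ((m - n) div 2) - q powi ((n - m) div 2)"

end

(* The Jacobi identity splits by degree. Its cubic part holds for every odd function c, and its
   linear part is the cocycle equation. For the given h the cocycle equation reduces, after
   cancelling the denominator of tanh, to the cyclic identity for the products
   sinh (a - r) sinh (m - n). Conversely, on index pairs (2n, 2m) with n + m = S fixed, the addition formulas
   for tanh turn a special case of the cocycle equation into the proportionality
   f(n) sinh (S - 2m) = f(m) sinh (S - 2n), which determines h up to a factor depending on S. *)

theory Submission
  imports Defs
begin

section \<open>Products and derivatives of formal series\<close>

lemma finite_submultisets: "finite {P. P \<subseteq># (M :: 'a multiset)}"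
proof (induction M)
  case empty
  then show ?case by simp
next
  case (add x M)
  have "{P. P \<subseteq># add_mset x M} \<subseteq> {P. P \<subseteq># M} \<union> add_mset x ` {P. P \<subseteq># M}"
  proof
    fix P assume "P \<in> {P. P \<subseteq># add_mset x M}"
    then have P: "P \<subseteq># add_mset x M" by simp
    show "P \<in> {P. P \<subseteq># M} \<union> add_mset x ` {P. P \<subseteq># M}"
    proof (cases "x \<in># P")
      case True
      then obtain Q where "P = add_mset x Q" by (metis insert_DiffM)
      with P show ?thesis by auto
    next
      case False
      with P show ?thesis
        by (metis (no_types, lifting) UnI1 diff_single_trivial mem_Collect_eq subset_eq_diff_conv add_mset_add_single)
    qed
  qed
  then show ?case using add finite_subset by blast
qed

text \<open>Only the splitting \<open>P = A\<close> contributes to the convolution.\<close>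

lemma ser_mult_monomial:
  "ser_mult (\<lambda>M. if M = A then d else 0) g = (\<lambda>M. if A \<subseteq># M then d * g (M - A) else 0)"
  (is "?f = ?g")
proof
  fix M :: "int multiset"
  have "?f M = (\<Sum>P | P \<subseteq># M. if P = A then d * g (M - A) else 0)"
    unfolding ser_mult_def by (rule sum.cong) auto
  also have "\<dots> = ?g M" by (simp add: sum.delta finite_submultisets)
  finally show "?f M = ?g M" .
qed

lemma ser_mult_monomial_right:
  "ser_mult f (\<lambda>M. if M = {#} then d else 0) = (\<lambda>M. f M * d)" (is "?f = ?g")
proof
  fix M :: "int multiset"
  have "?f M = (\<Sum>P | P \<subseteq># M. if P = M then f M * d else 0)"
    unfolding ser_mult_def by (rule sum.cong) (auto simp: subset_mset.dual_order.antisym Diff_eq_empty_iff_mset)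
  also have "\<dots> = ?g M" by (simp add: sum.delta finite_submultisets)
  finally show "?f M = ?g M" .
qed

lemma ser_deriv_gen: "ser_deriv p (gen n) = (\<lambda>M. if M = {#} then (if p = n then 1 else 0) else 0)"
  by (rule ext) (auto simp: ser_deriv_def gen_def)

lemma Sum_any_delta: "Sum_any (\<lambda>i. if i = a then f i else 0) = f a"
proof -
  have "Sum_any (\<lambda>i. if i = a then f i else 0) = (\<Sum>i\<in>{a}. if i = a then f i else 0)"
    by (rule Sum_any.expand_superset) auto
  then show ?thesis by simp
qed

section \<open>Coefficients of the bracket of two generators\<close>

lemma gen_bracket_eval:
  "gen_bracket c h n m M =
    Sum_any (\<lambda>l. if M = {#n - 2 * l, m + 2 * l#} then c l else 0) + (if M = {#} then h n m else 0)"
proof -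
  have "ser_mult (const (c l)) (ser_mult (gen (n - 2 * l)) (gen (m + 2 * l))) M =
    (if M = {#n - 2 * l, m + 2 * l#} then c l else 0)" for l
  proof -
    have "(n - 2 * l \<in># M \<and> M - {#n - 2 * l#} = {#m + 2 * l#}) \<longleftrightarrow> M = {#n - 2 * l, m + 2 * l#}"
      by (metis add_mset_remove_trivial insert_DiffM union_single_eq_member)
    then show ?thesis
      unfolding const_def gen_def ser_mult_monomial by auto
  qed
  then show ?thesis
    unfolding gen_bracket_def ser_add_def ser_sum_def by (simp add: const_def)
qed

lemma gen_bracket_empty: "gen_bracket c h n m {#} = h n m"
  by (simp add: gen_bracket_eval)

lemma gen_bracket_eq_0: "size M \<noteq> 0 \<Longrightarrow> size M \<noteq> 2 \<Longrightarrow> gen_bracket c h n m M = 0"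
proof -
  assume M: "size M \<noteq> 0" "size M \<noteq> 2"
  then have "M \<noteq> {#n - 2 * l, m + 2 * l#}" for l by auto
  with M show ?thesis by (simp add: gen_bracket_eval)
qed

text \<open>The monomial is unordered, so it arises from \<open>l = (n - a) div 2\<close> and from
  \<open>l = (n - b) div 2\<close>. The two coincide for \<open>a = b\<close> and must then be
  counted once.\<close>

lemma gen_bracket_pair:
  "gen_bracket c h n m {#a, b#} =
    (if a + b = n + m \<and> even (n - a) then
       (if a = b then c ((n - a) div 2)
        else c ((n - a) div 2) + (if even (n - b) then c ((n - b) div 2) else 0))
     else if a + b = n + m \<and> even (n - b) then c ((n - b) div 2) else 0)"
proof -
  have iff: "{#a, b#} = {#n - 2 * l, m + 2 * l#} \<longleftrightarrow>
      a + b = n + m \<and> (n - a = 2 * l \<or> n - b = 2 * l)" for l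
    by (auto simp: add_eq_conv_ex)
  let ?S = "{l. a + b = n + m \<and> (n - a = 2 * l \<or> n - b = 2 * l)}"
  have "gen_bracket c h n m {#a, b#} = Sum_any (\<lambda>l. if l \<in> ?S then c l else 0)"
    unfolding gen_bracket_eval iff by simp
  \<comment> \<open>For odd differences \<open>div\<close> rounds down; the test
    \<open>l \<in> ?S\<close> discards every index that solves neither equation.\<close>
  also have "\<dots> = (\<Sum>l\<in>{(n - a) div 2, (n - b) div 2}. if l \<in> ?S then c l else 0)"
    by (rule Sum_any.expand_superset) auto
  finally have *: "gen_bracket c h n m {#a, b#} =
    (\<Sum>l\<in>{(n - a) div 2, (n - b) div 2}. if l \<in> ?S then c l else 0)" .
  have halves: "(\<Sum>l\<in>{x div 2, y div 2}. if x = 2 * l \<or> y = 2 * l then c l else 0) =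
      (if even x then (if x = y then c (x div 2) else c (x div 2) + (if even y then c (y div 2) else 0))
       else if even y then c (y div 2) else 0)" for x y :: int
  proof -
    have "odd x \<Longrightarrow> x \<noteq> 2 * l" "odd y \<Longrightarrow> y \<noteq> 2 * l" for l by auto
    then show ?thesis
      by (cases "even x"; cases "even y"; cases "x div 2 = y div 2") (auto elim!: evenE)
  qed
  show ?thesis
    unfolding * using halves[of "n - a" "n - b"] by (cases "a + b = n + m") simp_all
qed

section \<open>Brackets and double brackets with a generator\<close>

lemma bracket_gen:
  "bracket c h f (gen r) M =
    Sum_any (\<lambda>(p, r'). if r' = r then ser_mult (ser_deriv p f) (gen_bracket c h p r) M else 0)"
proof -
  have zero: "ser_mult (\<lambda>M. 0) g = (\<lambda>M. 0)" for g :: "'a series"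
    by (simp add: ser_mult_def fun_eq_iff)
  have "ser_mult (ser_mult (ser_deriv p f) (ser_deriv r' (gen r))) (gen_bracket c h p r') M =
    (if r' = r then ser_mult (ser_deriv p f) (gen_bracket c h p r) M else 0)" for p r'
    unfolding ser_deriv_gen ser_mult_monomial_right by (simp add: zero)
  then show ?thesis
    unfolding bracket_def ser_sum_def by (intro Sum_any.cong) (simp split: prod.split)
qed

text \<open>All partial derivatives of a constant vanish. This gives the centrality clause of
  \<open>central_extension\<close>.\<close>

lemma bracket_const: "bracket c h (const z) (gen r) = const 0"
proof -
  have "ser_deriv p (const z) = (\<lambda>M. 0)" for p and z :: 'a
    by (simp add: ser_deriv_def const_def fun_eq_iff)
  then have "ser_mult (ser_deriv p (const z)) g M = 0" for p g M and z :: 'a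
    by (simp add: ser_mult_def)
  then show ?thesis
    by (simp add: fun_eq_iff bracket_gen) (simp add: const_def split_def cong: if_cong)
qed

lemma bracket_gen_gen: "bracket c h (gen n) (gen m) = gen_bracket c h n m"
proof
  fix M
  have "ser_mult (ser_deriv p (gen n)) (gen_bracket c h p m) M =
      (if p = n then gen_bracket c h n m M else 0)" for p
    unfolding ser_deriv_gen ser_mult_monomial by simp
  then have "bracket c h (gen n) (gen m) M =
      Sum_any (\<lambda>i. if i = (n, m) then gen_bracket c h n m M else 0)"
    unfolding bracket_gen by (intro Sum_any.cong) (simp split: prod.split)
  then show "bracket c h (gen n) (gen m) M = gen_bracket c h n m M"
    by (simp only: Sum_any_delta)
qed

text \<open>The coefficient of \<open>s\<^sub>a\<close> in the derivative of \<open>{s\<^sub>n, s\<^sub>m}\<close> with respect to \<open>s\<^bsub>n+m-a\<^esub>\<close>.\<close>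

definition deriv_coeff :: "(int \<Rightarrow> 'z::comm_ring_1) \<Rightarrow> int \<Rightarrow> int \<Rightarrow> int \<Rightarrow> 'z" where
  "deriv_coeff c n m a = (if even a then c ((a - m) div 2) + c ((n - a) div 2) else 0)"

text \<open>The bracket conserves the total index \<open>n + m\<close>, so the derivative leaves a
  single generator, and the constant \<open>h n m\<close> drops out. For a square
  (\<open>a = p\<close>) the factor 2 from the derivative restores the two equal summands of
  \<open>deriv_coeff\<close>.\<close>

lemma ser_deriv_gen_bracket:
  assumes "even n" "even m"
  shows "ser_deriv p (gen_bracket c h n m) =
    (\<lambda>M. if M = {#n + m - p#} then deriv_coeff c n m (n + m - p) else 0)" (is "?f = ?g")
proof
  fix M :: "int multiset"
  show "?f M = ?g M"
  proof (cases "size M = 1")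
    case False
    then show ?thesis by (auto simp: ser_deriv_def gen_bracket_eq_0)
  next
    case True
    then obtain a where M: "M = {#a#}" by (metis size_1_singleton_mset)
    show ?thesis
    proof (cases "a = n + m - p")
      case False
      then show ?thesis by (auto simp: M ser_deriv_def gen_bracket_pair)
    next
      case True
      then have p: "p = n + m - a" by simp
      obtain N L where e: "n = 2 * N" "m = 2 * L" using assms by (metis evenE)
      show ?thesis
      proof (cases "even a")
        case False
        with assms have "odd p" by (simp add: p)
        with False assms show ?thesis
          by (simp add: M ser_deriv_def gen_bracket_pair deriv_coeff_def)
      next
        case True
        then obtain A where A: "a = 2 * A" by (rule evenE)
        define P where "P = N + L - A"
        have P: "p = 2 * P" "P + A = N + L" by (simp_all add: P_def p e A)
        have "N - A = P - L" "N - P = A - L" by (simp_all add: P_def)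
        note cP = this[THEN arg_cong[of _ _ c]]
        have half: "(2 * x - 2 * y) div 2 = x - y" for x y :: int by auto
        show ?thesis using P cP
          by (auto simp add: M ser_deriv_def gen_bracket_pair deriv_coeff_def e A half)
      qed
    qed
  qed
qed

text \<open>The sum over \<open>p\<close> is reindexed by the generator \<open>a = n + m - p\<close>
  that the derivative leaves behind. It must divide \<open>M\<close>, which makes the sum finite; a
  repeated index counts once, hence \<open>set_mset\<close>.\<close>

lemma bracket_gen_bracket_gen:
  assumes "even n" "even m"
  shows "bracket c h (bracket c h (gen n) (gen m)) (gen r) M =
    (\<Sum>a\<in>set_mset M. deriv_coeff c n m a * gen_bracket c h (n + m - a) r (M - {#a#}))"
    (is "?lhs = ?rhs")
proof -
  define F where "F p = deriv_coeff c n m (n + m - p) *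
    gen_bracket c h p r (M - {#n + m - p#})" for p
  have "?lhs = Sum_any (\<lambda>(p, r'). if r' = r \<and> n + m - p \<in># M then F p else 0)"
    unfolding bracket_gen_gen bracket_gen ser_deriv_gen_bracket[OF assms] ser_mult_monomial F_def
    by (intro Sum_any.cong) auto
  also have "\<dots> = (\<Sum>(p, r')\<in>(\<lambda>a. (n + m - a, r)) ` set_mset M.
      if r' = r \<and> n + m - p \<in># M then F p else 0)"
    by (rule Sum_any.expand_superset) (auto simp: image_iff split: if_splits intro!: bexI[of _ "n + m - _"])
  also have "\<dots> = ?rhs"
    by (subst sum.reindex) (auto simp: inj_on_def F_def intro!: sum.cong)
  finally show ?thesis .
qed

section \<open>The Jacobi identity by degree: cocycle equation and cubic part\<close>

definition cocycle :: "(int \<Rightarrow> 'z::comm_ring_1) \<Rightarrow> (int \<Rightarrow> int \<Rightarrow> 'z) \<Rightarrow> bool" where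
  "cocycle c h \<longleftrightarrow> (\<forall>n m r a. even n \<longrightarrow> even m \<longrightarrow> even r \<longrightarrow> even a \<longrightarrow>
     deriv_coeff c n m a * h (n + m - a) r + (deriv_coeff c m r a * h (m + r - a) n +
     deriv_coeff c r n a * h (r + n - a) m) = 0)"

text \<open>Brackets conserve the total index and shift indices by even amounts, so no other cubic
  monomial is produced.\<close>

lemma deriv_coeff_gen_bracket_eq_0:
  assumes "even i" "even j" "even k" "\<not> (even a \<and> even b \<and> even d \<and> a + b + d = i + j + k)"
  shows "deriv_coeff c i j a * gen_bracket c h (i + j - a) k {#b, d#} = 0"
proof (cases "even a \<and> a + b + d = i + j + k")
  case True
  then have "odd b" "odd d" using assms by presburger+
  with True assms show ?thesis by (simp add: gen_bracket_pair)
next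
  case False
  then show ?thesis by (auto simp: gen_bracket_pair deriv_coeff_def)
qed

text \<open>
  With \<open>n = 2N\<close>, \<open>x = 2X\<close> and so on, everything is a quadratic form in the nine values
  \<open>c (N - X), c (N - Y), \<dots>, c (R - Z)\<close>; a product such as \<open>c (N - X) * c (R - Y)\<close> arises from two of the
  three summands, with opposite signs. Only the oddness of \<open>c\<close> matters, not its values.
\<close>

lemma quadratic_jacobi:
  fixes c :: "int \<Rightarrow> 'z::comm_ring_1"
  assumes c_odd: "\<And>l. c (- l) = - c l" and ev: "even n" "even m" "even r"
  shows "(\<Sum>a\<in>set_mset {#x, y, z#}. deriv_coeff c n m a * gen_bracket c h (n + m - a) r ({#x, y, z#} - {#a#}))
   + ((\<Sum>a\<in>set_mset {#x, y, z#}. deriv_coeff c m r a * gen_bracket c h (m + r - a) n ({#x, y, z#} - {#a#}))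
   + (\<Sum>a\<in>set_mset {#x, y, z#}. deriv_coeff c r n a * gen_bracket c h (r + n - a) m ({#x, y, z#} - {#a#}))) = 0"
proof -
  have rem: "{#x, y, z#} - {#x#} = {#y, z#}" "{#x, y, z#} - {#y#} = {#x, z#}" "{#x, y, z#} - {#z#} = {#x, y#}"
    by (simp_all add: add_mset_commute)
  show ?thesis
  proof (cases "even x \<and> even y \<and> even z \<and> x + y + z = n + m + r")
    case False
    have "(\<Sum>a\<in>set_mset {#x, y, z#}. deriv_coeff c i j a * gen_bracket c h (i + j - a) k ({#x, y, z#} - {#a#})) = 0"
      if "even i" "even j" "even k" "i + j + k = n + m + r" for i j k
    proof (rule sum.neutral, rule ballI)
      fix a assume "a \<in> set_mset {#x, y, z#}"
      then consider "a = x" | "a = y" | "a = z" by auto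
      then show "deriv_coeff c i j a * gen_bracket c h (i + j - a) k ({#x, y, z#} - {#a#}) = 0"
        by cases (simp_all only: rem, (rule deriv_coeff_gen_bracket_eq_0; use that False in auto)+)
    qed
    from this[OF ev] this[OF ev(2,3,1)] this[OF ev(3,1,2)] show ?thesis by simp
  next
    case True
    obtain N M R X Y Z where e: "n = 2 * N" "m = 2 * M" "r = 2 * R" "x = 2 * X" "y = 2 * Y" "z = 2 * Z"
      using True ev by (metis evenE)
    have s: "X + Y + Z = N + M + R" using True e by auto
    have D: "deriv_coeff c (2 * i) (2 * j) (2 * a) = c (i - a) - c (j - a)" for i j a
    proof -
      have "(2 * a - 2 * j) div 2 = - (j - a)" "(2 * i - 2 * a) div 2 = i - a" by auto
      then show ?thesis using c_odd[of "j - a"] by (simp add: deriv_coeff_def)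
    qed
    \<comment> \<open>Oddness of \<open>c\<close> turns the arguments into differences with
      \<open>k\<close>, so that only the nine basic values remain.\<close>
    have B: "gen_bracket c h (2 * i + 2 * j - 2 * a) (2 * k) {#2 * b, 2 * d#} =
        (if b = d then - c (k - b) else - c (k - b) - c (k - d))"
      if "a + b + d = i + j + k" for i j k a b d
    proof -
      have "i + j - a - b = d - k" "i + j - a - d = b - k" using that by auto
      from this[THEN arg_cong[of _ _ c]]
      have "c (i + j - a - b) = - c (k - d)" "c (i + j - a - d) = - c (k - b)"
        using c_odd[of "k - d"] c_odd[of "k - b"] by simp_all
      then show ?thesis using that by (auto simp: gen_bracket_pair)
    qed
    \<comment> \<open>Each row fixes the index in the role of \<open>a\<close>, each column a cyclic
      rotation of \<open>N, M, R\<close>: nine instances of \<open>B\<close>.\<close>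
    have eqs: "X + Y + Z = N + M + R" "X + Y + Z = M + R + N" "X + Y + Z = R + N + M"
       "Y + X + Z = N + M + R" "Y + X + Z = M + R + N" "Y + X + Z = R + N + M"
       "Z + X + Y = N + M + R" "Z + X + Y = M + R + N" "Z + X + Y = R + N + M"
      using s by auto
    note Bs = eqs[THEN B]
    \<comment> \<open>The tests for equality keep a repeated index from being counted twice.\<close>
    have sums: "(\<Sum>a\<in>set_mset {#x, y, z#}. F a ({#x, y, z#} - {#a#})) =
      F x {#y, z#} + (if y = x then 0 else F y {#x, z#}) + (if z = x \<or> z = y then 0 else F z {#x, y#})"
      for F :: "int \<Rightarrow> int multiset \<Rightarrow> 'z"
    proof -
      have "set_mset {#x, y, z#} = insert x (insert y {z})" by simp
      then show ?thesis
        using rem by (cases "x = y"; cases "x = z"; cases "y = z")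
          (simp_all add: algebra_simps insert_commute add_mset_commute)
    qed
    show ?thesis
      unfolding
        sums[of "\<lambda>a M. deriv_coeff c n m a * gen_bracket c h (n + m - a) r M"]
        sums[of "\<lambda>a M. deriv_coeff c m r a * gen_bracket c h (m + r - a) n M"]
        sums[of "\<lambda>a M. deriv_coeff c r n a * gen_bracket c h (r + n - a) m M"]
      unfolding e D Bs
      by (cases "X = Y"; cases "X = Z"; cases "Y = Z") (simp_all add: algebra_simps)
  qed
qed

text \<open>A double bracket multiplies one remaining generator by a bracket of degree 0 or 2, so
  only degrees 1 and 3 occur. Degree 3 cancels by \<open>quadratic_jacobi\<close>; degree 1 is
  \<open>cocycle\<close>.\<close>

lemma jacobi_on_gens_iff_cocycle:
  fixes c :: "int \<Rightarrow> 'z::comm_ring_1"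
  assumes c_odd: "\<And>l. c (- l) = - c l"
  shows "jacobi_on_gens c h \<longleftrightarrow> cocycle c h"
proof -
  define J where "J n m r M =
     (\<Sum>a\<in>set_mset M. deriv_coeff c n m a * gen_bracket c h (n + m - a) r (M - {#a#}))
   + ((\<Sum>a\<in>set_mset M. deriv_coeff c m r a * gen_bracket c h (m + r - a) n (M - {#a#}))
   + (\<Sum>a\<in>set_mset M. deriv_coeff c r n a * gen_bracket c h (r + n - a) m (M - {#a#})))" for n m r M
  have "jacobi_on_gens c h \<longleftrightarrow> (\<forall>n m r. even n \<longrightarrow> even m \<longrightarrow> even r \<longrightarrow> (\<forall>M. J n m r M = 0))"
    unfolding jacobi_on_gens_def J_def fun_eq_iff
    by (simp add: ser_add_def const_def bracket_gen_bracket_gen)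
  moreover have "(\<forall>M. J n m r M = 0) \<longleftrightarrow> (\<forall>a. J n m r {#a#} = 0)"
    if "even n" "even m" "even r" for n m r
  proof (intro iffI allI)
    fix M :: "int multiset" assume single: "\<forall>a. J n m r {#a#} = 0"
    consider a where "M = {#a#}" | x y z where "M = {#x, y, z#}" | "size M \<noteq> 1" "size M \<noteq> 3"
    proof (cases "size M = 3")
      case True
      then obtain x M' where "M = add_mset x M'" "size M' = 2"
        by (metis size_eq_Suc_imp_eq_union numeral_2_eq_2 numeral_3_eq_3 size_add_mset Suc_inject)
      then show thesis
        using that(2) by (metis size_eq_Suc_imp_eq_union numeral_2_eq_2 size_1_singleton_mset One_nat_def size_add_mset Suc_inject)
    qed (use that size_1_singleton_mset in metis)
    then show "J n m r M = 0"
    proof cases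
      case 3
      have "gen_bracket c h i j (M - {#a#}) = 0" if mem: "a \<in># M" for i j a
      proof -
        obtain M' where "M = add_mset a M'" using multi_member_split[OF mem] by blast
        with 3 show ?thesis by (intro gen_bracket_eq_0) simp_all
      qed
      then show ?thesis by (simp add: J_def)
    qed (use single quadratic_jacobi[of c, OF c_odd that] in \<open>auto simp only: J_def\<close>)
  qed simp
  moreover have "(\<forall>a. J n m r {#a#} = 0) \<longleftrightarrow> (\<forall>a. even a \<longrightarrow> J n m r {#a#} = 0)" for n m r
    by (auto simp: J_def deriv_coeff_def)
  ultimately show ?thesis
    unfolding cocycle_def by (auto simp: J_def gen_bracket_empty)
qed

lemma central_extension_iff_cocycle:
  assumes "\<And>l. c (- l) = - c l"
  shows "central_extension c h \<longleftrightarrow> (\<forall>n m. even n \<longrightarrow> even m \<longrightarrow> h n m = - h m n) \<and> cocycle c h"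
  unfolding central_extension_def jacobi_on_gens_iff_cocycle[of c, OF assms] by (simp add: bracket_const)

section \<open>Hyperbolic identities and the cocycle equation in halved indices\<close>

text \<open>The three-term Pluecker relation: \<open>q powi (x - y) - q powi (y - x)\<close> is the
  determinant with columns \<open>(q powi x, q powi (- x))\<close> and
  \<open>(q powi y, q powi (- y))\<close>.\<close>

lemma powi_sum_eq_0_cyclic:
  fixes q :: complex
  assumes "q \<noteq> 0"
  shows "(q powi (a - r) - q powi (r - a)) * (q powi (m - n) - q powi (n - m)) +
    (q powi (a - m) - q powi (m - a)) * (q powi (n - r) - q powi (r - n)) +
    (q powi (a - n) - q powi (n - a)) * (q powi (r - m) - q powi (m - r)) = 0"
  using assms by (simp add: power_int_diff field_simps)

lemma c_coeff_minus: "c_coeff q (- l) = - c_coeff q l"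
proof -
  have "q powi (- l) - q powi l = - (q powi l - q powi (- l))" by simp
  then show ?thesis
    by (simp only: c_coeff_def minus_minus add.commute[of "q powi (- l)"] minus_divide_left[symmetric]
        mult_minus_right)
qed

text \<open>The difference of the two values of \<open>h_coeff\<close> factors as a cosh in
  \<open>a - r\<close> times a sinh in \<open>n - m\<close>, and the cosh cancels the denominator of
  \<open>c_coeff\<close>.\<close>

lemma c_coeff_mult_h_coeff_diff:
  assumes "q \<noteq> 0" and "q powi (a - r) + q powi (r - a) \<noteq> 0"
  shows "c_coeff q (a - r) * (h_coeff q (2 * (m + r - a)) (2 * n) - h_coeff q (2 * (n + r - a)) (2 * m)) =
    2 * Ln q * ((q powi (a - r) - q powi (r - a)) * (q powi (m - n) - q powi (n - m)))"
proof -
  have *: "h_coeff q (2 * (m + r - a)) (2 * n) - h_coeff q (2 * (n + r - a)) (2 * m) =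
     (q powi (a - r) + q powi (r - a)) * (q powi (n - m) - q powi (m - n))"
  proof -
    have half: "(2 * x - 2 * y) div 2 = x - y" for x y :: int by auto
    have "q powi (n - (m + r - a)) = q powi (a - r) * q powi (n - m)"
      "q powi (m + r - a - n) = q powi (r - a) * q powi (m - n)"
      "q powi (m - (n + r - a)) = q powi (a - r) * q powi (m - n)"
      "q powi (n + r - a - m) = q powi (r - a) * q powi (n - m)"
      using assms(1) by (simp_all add: power_int_add[symmetric] algebra_simps)
    then show ?thesis by (simp only: h_coeff_def half) (simp add: algebra_simps)
  qed
  show ?thesis using assms(2) unfolding * c_coeff_def by (simp add: field_simps)
qed

text \<open>The formula tanh u + tanh v = sinh (u + v) / (cosh u cosh v), with arguments scaled by
  \<open>Ln q\<close>.\<close>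

lemma c_coeff_add:
  fixes q :: complex
  assumes q: "q \<noteq> 0" and nz: "q powi u + q powi (- u) \<noteq> 0" "q powi v + q powi (- v) \<noteq> 0"
  shows "c_coeff q u + c_coeff q v =
    - 4 * Ln q / ((q powi u + q powi (- u)) * (q powi v + q powi (- v))) *
      (q powi (u + v) - q powi (- (u + v)))"
proof -
  have "q powi (- u - v) = q powi (- u) * q powi (- v)" "q powi (u + v) = q powi u * q powi v"
    using q by (simp_all add: power_int_add[symmetric])
  then have *: "q powi (u + v) - q powi (- (u + v)) = q powi u * q powi v - q powi (- u) * q powi (- v)"
    by simp
  show ?thesis
    unfolding * c_coeff_def using nz by (simp add: divide_simps) (simp add: algebra_simps)
qed

text \<open>Oddness splits each \<open>deriv_coeff\<close> into a difference, and the terms are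
  regrouped by values of \<open>c\<close>. For antisymmetric \<open>h\<close> this is, up to a
  global sign, the usual cocycle equation; doubling the indices absorbs the parity
  conditions.\<close>

lemma cocycle_double:
  assumes c_odd: "\<And>l. c (- l) = - c l"
  shows "cocycle c h \<longleftrightarrow> (\<forall>n m r a.
      c (a - r) * (h (2 * (m + r - a)) (2 * n) - h (2 * (n + r - a)) (2 * m)) +
      c (a - m) * (h (2 * (n + m - a)) (2 * r) - h (2 * (r + m - a)) (2 * n)) +
      c (a - n) * (h (2 * (r + n - a)) (2 * m) - h (2 * (m + n - a)) (2 * r)) = 0)"
    (is "_ \<longleftrightarrow> (\<forall>n m r a. ?E n m r a = 0)")
proof -
  have D: "deriv_coeff c (2 * i) (2 * j) (2 * a) = c (a - j) - c (a - i)" for i j a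
  proof -
    have "(2 * a - 2 * j) div 2 = a - j" "(2 * i - 2 * a) div 2 = i - a" by auto
    then show ?thesis using c_odd[of "a - i"] by (simp add: deriv_coeff_def)
  qed
  have H: "h (2 * i + 2 * j - 2 * a) k = h (2 * (i + j - a)) k" "h (2 * (i + j - a)) k = h (2 * (j + i - a)) k" for i j a k
    by (simp_all add: algebra_simps)
  have E: "deriv_coeff c (2 * n) (2 * m) (2 * a) * h (2 * n + 2 * m - 2 * a) (2 * r) +
    (deriv_coeff c (2 * m) (2 * r) (2 * a) * h (2 * m + 2 * r - 2 * a) (2 * n) +
     deriv_coeff c (2 * r) (2 * n) (2 * a) * h (2 * r + 2 * n - 2 * a) (2 * m)) = ?E n m r a" for n m r a
    unfolding D H(1) H(2)[of n r] H(2)[of r m] H(2)[of m n] by (simp add: ring_distribs)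
  have "cocycle c h \<longleftrightarrow> (\<forall>n m r a. deriv_coeff c (2 * n) (2 * m) (2 * a) * h (2 * n + 2 * m - 2 * a) (2 * r) +
    (deriv_coeff c (2 * m) (2 * r) (2 * a) * h (2 * m + 2 * r - 2 * a) (2 * n) +
     deriv_coeff c (2 * r) (2 * n) (2 * a) * h (2 * r + 2 * n - 2 * a) (2 * m)) = 0)"
    unfolding cocycle_def by (safe; (elim evenE)?; simp)
  then show ?thesis unfolding E .
qed

text \<open>The homomorphism \<open>\<iota>\<close> makes \<open>'z\<close> a complex algebra, so
  \<open>\<xi>\<close> may take any central values. The second half shows that the family is
  exhaustive when \<open>q\<close> is not a root of unity.\<close>

theorem mainTheorem2:
  fixes q :: complex and \<iota> :: "complex \<Rightarrow> 'z::comm_ring_1"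
  assumes "\<iota> 1 = 1" and "\<And>x y. \<iota> (x + y) = \<iota> x + \<iota> y" and "\<And>x y. \<iota> (x * y) = \<iota> x * \<iota> y"
    and "q \<noteq> 0" and "\<And>l :: int. q powi l + q powi (- l) \<noteq> 0"
  shows "(\<forall>\<xi> :: int \<Rightarrow> 'z.
            central_extension (\<lambda>l. \<iota> (c_coeff q l)) (\<lambda>n m. \<xi> (n + m) * \<iota> (h_coeff q n m))) \<and>
         ((\<forall>j :: nat. j > 0 \<longrightarrow> q ^ j \<noteq> 1) \<longrightarrow>
          (\<forall>h :: int \<Rightarrow> int \<Rightarrow> 'z. central_extension (\<lambda>l. \<iota> (c_coeff q l)) h \<longrightarrow>
             (\<exists>\<xi> :: int \<Rightarrow> 'z. \<forall>n m. even n \<longrightarrow> even m \<longrightarrow>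
                h n m = \<xi> (n + m) * \<iota> (h_coeff q n m))))"
proof (intro conjI allI impI)
  let ?c = "\<lambda>l. \<iota> (c_coeff q l)"
  note hom = assms(1-3)
  have \<iota>0: "\<iota> 0 = 0" using hom(2)[of 0 0] by simp
  have \<iota>_minus: "\<iota> (- x) = - \<iota> x" for x
    using hom(2)[of x "- x"] \<iota>0 by (simp add: eq_neg_iff_add_eq_0 add.commute)
  have \<iota>_diff: "\<iota> (x - y) = \<iota> x - \<iota> y" for x y
    using hom(2)[of x "- y"] \<iota>_minus by simp
  have c_odd: "?c (- l) = - ?c l" for l by (simp add: c_coeff_minus \<iota>_minus)
  have q_sum: "q powi (x - y) + q powi (y - x) \<noteq> 0" for x y
    using assms(5)[of "x - y"] by simp
  have h_coeff_swap: "h_coeff q n m = - h_coeff q m n" for n m by (simp add: h_coeff_def)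
  have half: "(2 * x - 2 * y) div 2 = x - y" for x y :: int by auto
  {
    fix \<xi> :: "int \<Rightarrow> 'z"
    let ?h = "\<lambda>n m. \<xi> (n + m) * \<iota> (h_coeff q n m)"
    have antisym: "?h n m = - ?h m n" for n m
      using h_coeff_swap[of n m] by (simp add: \<iota>_minus add.commute)
    \<comment> \<open>Every value of \<open>h\<close> here has total index
      \<open>2 * (n + m + r - a)\<close>, so \<open>\<xi>\<close> factors out of the whole equation;
      this is why it can be arbitrary.\<close>
    have scale: "?c (a - r) * (?h (2 * (m + r - a)) (2 * n) - ?h (2 * (n + r - a)) (2 * m)) =
      \<xi> (2 * (n + m + r - a)) * \<iota> (2 * Ln q *
        ((q powi (a - r) - q powi (r - a)) * (q powi (m - n) - q powi (n - m))))" for n m r a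
    proof -
      have "2 * (m + r - a) + 2 * n = 2 * (n + m + r - a)" "2 * (n + r - a) + 2 * m = 2 * (n + m + r - a)"
        by simp_all
      then show ?thesis
        unfolding c_coeff_mult_h_coeff_diff[OF assms(4) q_sum, symmetric] hom(3) \<iota>_diff
        by (simp only: right_diff_distrib mult.left_commute)
    qed
    have "cocycle ?c ?h"
    proof (subst cocycle_double[of ?c, OF c_odd], intro allI)
      fix n m r a :: int
      have "r + n + m - a = n + m + r - a" "m + r + n - a = n + m + r - a" by simp_all
      then show "?c (a - r) * (?h (2 * (m + r - a)) (2 * n) - ?h (2 * (n + r - a)) (2 * m)) +
        ?c (a - m) * (?h (2 * (n + m - a)) (2 * r) - ?h (2 * (r + m - a)) (2 * n)) +
        ?c (a - n) * (?h (2 * (r + n - a)) (2 * m) - ?h (2 * (m + n - a)) (2 * r)) = 0"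
        unfolding scale
        by (simp only: distrib_left[symmetric] hom(2)[symmetric] powi_sum_eq_0_cyclic[OF assms(4)]
            mult_zero_right \<iota>0)
    qed
    then show "central_extension ?c ?h"
      unfolding central_extension_iff_cocycle[of ?c, OF c_odd] using antisym by blast
  }
  fix h :: "int \<Rightarrow> int \<Rightarrow> 'z"
  assume q_not_root: "\<forall>j :: nat. j > 0 \<longrightarrow> q ^ j \<noteq> 1" and ext: "central_extension ?c h"
  have antisym: "h n m = - h m n" if "even n" "even m" for n m
    using ext that unfolding central_extension_iff_cocycle[of ?c, OF c_odd] by blast
  define s where "s x = q powi x - q powi (- x)" for x :: int
  have s_nonzero: "s x \<noteq> 0" if "x \<noteq> 0" for x
  proof
    assume "s x = 0"
    then have "q powi x * q powi x = q powi x * q powi (- x)" by (simp add: s_def)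
    then have "q powi (2 * x) = 1"
      using assms(4) by (simp flip: power_int_add)
    then have "q powi (2 * \<bar>x\<bar>) = 1"
      by (cases "x \<ge> 0") (simp_all add: power_int_minus)
    moreover have "q powi (2 * \<bar>x\<bar>) = q ^ nat (2 * \<bar>x\<bar>)"
      by (simp add: power_int_def)
    ultimately show False using q_not_root that by auto
  qed
  \<comment> \<open>For \<open>q = 1\<close> all \<open>c_coeff\<close> vanish and the cocycle
    equation would not constrain \<open>h\<close>.\<close>
  have "q \<noteq> 1" using q_not_root by (metis power_one zero_less_one)
  then have Ln_nonzero: "Ln q \<noteq> 0" using assms(4) by (metis exp_Ln exp_zero)
  have "cocycle ?c h"
    using ext unfolding central_extension_iff_cocycle[of ?c, OF c_odd] by blast
  then have cocycle: "\<forall>n m r a.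
      ?c (a - r) * (h (2 * (m + r - a)) (2 * n) - h (2 * (n + r - a)) (2 * m)) +
      ?c (a - m) * (h (2 * (n + m - a)) (2 * r) - h (2 * (r + m - a)) (2 * n)) +
      ?c (a - n) * (h (2 * (r + n - a)) (2 * m) - h (2 * (m + n - a)) (2 * r)) = 0"
    by (subst (asm) cocycle_double[of ?c, OF c_odd]) assumption+
  \<comment> \<open>Taking \<open>r = S - n\<close> and \<open>a = m\<close> in the cocycle equation kills the middle term and
    leaves a relation between \<open>f S n\<close> and \<open>f S m\<close> only.\<close>
  define f where "f S n = h (2 * n) (2 * (S - n))" for S n
  have proportional: "f S n * \<iota> (s (S - 2 * m)) = f S m * \<iota> (s (S - 2 * n))" for S n m
  proof -
    \<comment> \<open>These are the arguments \<open>a - r\<close> and \<open>a - n\<close> of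
      \<open>c\<close> after the substitution; up to sign, \<open>u + v\<close> and
      \<open>u - v\<close> are the two arguments of \<open>s\<close>.\<close>
    define u v where "u = n + m - S" and "v = m - n"
    have uv: "u + v = - (S - 2 * m)" "u + - v = - (S - 2 * n)" by (simp_all add: u_def v_def)
    \<comment> \<open>The denominator in \<open>c_coeff_add\<close> is even in \<open>v\<close>, so
      sum and difference share this prefactor; its sign absorbs the minus signs in
      \<open>uv\<close>.\<close>
    define K where "K = 4 * Ln q / ((q powi u + q powi (- u)) * (q powi v + q powi (- v)))"
    have "K \<noteq> 0" using Ln_nonzero assms(5) by (simp add: K_def)
    have K: "c_coeff q u + c_coeff q v = K * s (S - 2 * m)"
      "c_coeff q u - c_coeff q v = K * s (S - 2 * n)"
      using c_coeff_add[OF assms(4) assms(5)[of u] assms(5)[of v]]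
        c_coeff_add[OF assms(4) assms(5)[of u] assms(5)[of "- v"]]
      unfolding uv c_coeff_minus minus_minus K_def s_def
      by (simp_all add: add.commute right_diff_distrib)
    have f_swap: "h (2 * (S - k)) (2 * k) = - f S k" for k
      using antisym[of "2 * (S - k)" "2 * k"] by (simp add: f_def)
    have "m - (S - n) = u" "m + (S - n) - m = S - n" "n + (S - n) - m = S - m" "m - m = 0"
        "n + m - m = n" "S - n + m - m = S - n" "S - n + n - m = S - m" "m + n - m = n"
      by (simp_all add: u_def)
    then have "?c u * (- f S n - - f S m) + ?c 0 * (f S n - - f S n) + ?c v * (- f S m - f S n) = 0"
      using cocycle[rule_format, where a = m and r = "S - n" and m = m and n = n] by (simp only: f_swap f_def[symmetric] v_def[symmetric])
    moreover have "?c 0 = 0" using \<iota>0 by (simp add: c_coeff_def)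
    ultimately have "f S n * (?c u + ?c v) = f S m * (?c u - ?c v)"
      by (simp add: algebra_simps eq_neg_iff_add_eq_0)
    then have "f S n * \<iota> (s (S - 2 * m)) * \<iota> K = f S m * \<iota> (s (S - 2 * n)) * \<iota> K"
      unfolding hom(2)[symmetric] \<iota>_diff[symmetric] K hom(3) by (simp only: ac_simps)
    \<comment> \<open>Since \<open>'z\<close> may have zero divisors, \<open>\<iota> K\<close> is
      cancelled through its explicit inverse \<open>\<iota> (inverse K)\<close>.\<close>
    then have "f S n * \<iota> (s (S - 2 * m)) * \<iota> (K * inverse K) =
        f S m * \<iota> (s (S - 2 * n)) * \<iota> (K * inverse K)"
      unfolding hom(3) mult.assoc[symmetric] by simp
    then show ?thesis using \<open>K \<noteq> 0\<close> hom(1) by simp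
  qed
  \<comment> \<open>Any \<open>n\<close> with \<open>S \<noteq> 2 * n\<close> would do for normalising.\<close>
  define \<xi> where "\<xi> k = (let S = k div 2; n = (S - 1) div 2 in f S n * \<iota> (inverse (s (S - 2 * n))))" for k
  have "h (2 * n) (2 * m) = \<xi> (2 * n + 2 * m) * \<iota> (h_coeff q (2 * n) (2 * m))" for n m
  proof -
    define S where "S = n + m"
    define n0 where "n0 = (S - 1) div 2"
    \<comment> \<open>The difference is 1 for odd \<open>S\<close> and 2 for even
      \<open>S\<close>.\<close>
    have "S - 2 * n0 \<noteq> 0" unfolding n0_def by presburger
    then have inv: "\<iota> (s (S - 2 * n0)) * \<iota> (inverse (s (S - 2 * n0))) = 1"
      using s_nonzero by (simp flip: hom(3) add: hom(1))
    have S: "(2 * n + 2 * m) div 2 = S" "S - n = m" by (simp_all add: S_def)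
    have "h (2 * n) (2 * m) = f S n" by (simp add: f_def S)
    also have "\<dots> = f S n * \<iota> (s (S - 2 * n0)) * \<iota> (inverse (s (S - 2 * n0)))"
      using inv by (simp add: mult.assoc)
    also have "\<dots> = \<xi> (2 * n + 2 * m) * \<iota> (s (S - 2 * n))"
      unfolding proportional[of S n n0] \<xi>_def S Let_def n0_def[symmetric] by (simp add: ac_simps)
    also have "s (S - 2 * n) = h_coeff q (2 * n) (2 * m)"
      by (simp add: s_def h_coeff_def half S_def)
    finally show ?thesis .
  qed
  then have "\<forall>n m. even n \<longrightarrow> even m \<longrightarrow> h n m = \<xi> (n + m) * \<iota> (h_coeff q n m)"
    by (auto elim!: evenE)
  then show "\<exists>\<xi> :: int \<Rightarrow> 'z. \<forall>n m. even n \<longrightarrow> even m \<longrightarrow> h n m = \<xi> (n + m) * \<iota> (h_coeff q n m)"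
    by blast
qed

end
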